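(* Let $\mathcal{M}$ be the family of $3$-graphs defined in the context. Then $\mathrm{ex}(n,\mathcal{M}) \le 2n^3/27$ for every positive integer $n$. Moreover, $\mathrm{ex}(n,\mathcal{M}) = 2n^3/27$ whenever $n$ is a multiple of six.
   Context: An $r$-graph is an $r$-uniform hypergraph. For a family $\mathcal{F}$ of $r$-graphs, an $r$-graph is $\mathcal{F}$-free if it contains no member of $\mathcal{F}$ as a (not necessarily induced) subgraph, and $\mathrm{ex}(n,\mathcal{F})$ is the maximum number of edges of an $\mathcal{F}$-free $r$-graph on $n$ vertices. A subgraph of an $r$-graph $\mathcal{H}$ is "contained in" $\mathcal{H}$ if it is isomorphic to a subgraph of $\mathcal{H}$. Transversal number: for a $3$-graph $\mathcal{H}$, $\tau(\mathcal{H})$ is the minimum size of a vertex set meeting every edge of $\mathcal{H}$ ($\tau=0$ if $\mathcal{H}$ has no edges). For $\ell \ge 3$, $\mathcal{K}^3_{\ell+1}$ is the collection of all $3$-graphs $F$ on at most $(\ell+1)+\binom{\ell+1}{2}$ vertices such that for some $(\ell+1)$-set $S\subseteq V(F)$ (called a core of $F$) every pair $\{u,v\}\subseteq S$ is contained in some edge of $F$. Blowup: if $\mathcal{T}$ is a $3$-graph on vertex set $[s]$ and $t=(t_1,\dots,t_s)$ are positive integers, the blowup $\mathcal{T}(t)$ is obtained by replacing each vertex $i$ by a set of size $t_i$ (the sets pairwise disjoint) and each edge of $\mathcal{T}$ by the complete $3$-partite $3$-graph on the corresponding three sets. $\mathcal{G}^1_n$: take disjoint sets $A,B$ with $|A|=\lfloor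 n/3\rfloor$, $|B|=\lceil 2n/3\rceil$; $\mathcal{G}^1_n=\{\{a,b,b'\}: a\in A,\ \{b,b'\}\subseteq B\}$. $\mathcal{G}^2_6$ is the $3$-graph on $[6]$ whose edge set is all $3$-subsets of $[6]$ except $\{1,2,3\},\{1,2,6\},\{3,4,5\},\{4,5,6\}$. For $n>6$, $\mathcal{G}^2_n$ is a blowup of $\mathcal{G}^2_6$ on $n$ vertices with the maximum number of edges. $\mathcal{M}=M_1\cup M_2\cup M_3$, where: $M_1=\{K_5^{3-}\}$, $K_5^{3-}$ being the complete $3$-graph on five vertices with one edge removed; $M_2$ is the set of all $F\in\mathcal{K}^3_7$ having a core $S$ such that the induced subgraph $F[S]$ satisfies $\tau(F[S])\ge 2$; $M_3$ is the set of all $F\in\mathcal{K}^3_6$ such that $F$ is not contained in $\mathcal{G}^1_n$ for any positive integer $n$ and $F$ is not contained in $\mathcal{G}^2_n$ for any $n\ge 6$. *)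

theory Defs
  imports Complex_Main
begin

type_synonym 'a hgraph = "'a set \<times> 'a set set"

definition triples :: "'a set \<Rightarrow> 'a set set" where
  "triples V = {e. e \<subseteq> V \<and> card e = 3}"

definition is_3graph :: "'a hgraph \<Rightarrow> bool" where
  "is_3graph H \<longleftrightarrow> finite (fst H) \<and> snd H \<subseteq> triples (fst H)"

definition contained :: "'a hgraph \<Rightarrow> 'b hgraph \<Rightarrow> bool" where
  "contained F H \<longleftrightarrow> (\<exists>f. inj_on f (fst F) \<and> f ` fst F \<subseteq> fst H \<and>
                          (\<forall>e\<in>snd F. f ` e \<in> snd H))"

definition free :: "'a hgraph set \<Rightarrow> 'b hgraph \<Rightarrow> bool" where
  "free Fam H \<longleftrightarrow> (\<forall>F\<in>Fam. \<not> contained F H)"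

definition ex :: "nat \<Rightarrow> 'a hgraph set \<Rightarrow> nat" where
  "ex n Fam = Max {card E | E. E \<subseteq> triples {0..<n} \<and> free Fam ({0..<n::nat}, E)}"

definition induced :: "'a hgraph \<Rightarrow> 'a set \<Rightarrow> 'a hgraph" where
  "induced H S = (S, {e \<in> snd H. e \<subseteq> S})"

definition tau :: "'a hgraph \<Rightarrow> nat" where
  "tau H = Min {card T | T. T \<subseteq> fst H \<and> (\<forall>e\<in>snd H. T \<inter> e \<noteq> {})}"

definition is_core :: "'a hgraph \<Rightarrow> 'a set \<Rightarrow> nat \<Rightarrow> bool" where
  "is_core F S k \<longleftrightarrow> S \<subseteq> fst F \<and> card S = k \<and>
     (\<forall>u\<in>S. \<forall>v\<in>S. u \<noteq> v \<longrightarrow> (\<exists>e\<in>snd F. {u, v} \<subseteq> e))"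

text \<open>The family K^3_k (k = l+1), members taken with vertices in nat (families are
  only used up to isomorphism).\<close>
definition Kfam :: "nat \<Rightarrow> nat hgraph set" where
  "Kfam k = {F. is_3graph F \<and> card (fst F) \<le> k + (k choose 2) \<and> (\<exists>S. is_core F S k)}"

definition K5minus :: "nat hgraph" where
  "K5minus = ({0..<5}, triples {0..<5} - {{0,1,2}})"

definition G1 :: "nat \<Rightarrow> nat hgraph" where
  "G1 n = ({0..<n}, {{a, b, b'} | a b b'. a \<in> {0..<n div 3} \<and> b \<in> {n div 3..<n}
                                      \<and> b' \<in> {n div 3..<n} \<and> b \<noteq> b'})"

definition G26_edges :: "nat set set" where
  "G26_edges = triples {1..6} - {{1,2,3},{1,2,6},{3,4,5},{4,5,6}}"

text \<open>Blowup of G^2_6 on vertex set {0..<n} determined by a part map p onto {1..6}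
  (all parts nonempty).\<close>
definition blowup_edges :: "nat \<Rightarrow> (nat \<Rightarrow> nat) \<Rightarrow> nat set set" where
  "blowup_edges n p = {e \<in> triples {0..<n}. card (p ` e) = 3 \<and> p ` e \<in> G26_edges}"

definition is_blowup_part :: "nat \<Rightarrow> (nat \<Rightarrow> nat) \<Rightarrow> bool" where
  "is_blowup_part n p \<longleftrightarrow> p ` {0..<n} = {1..6}"

definition is_max_blowup :: "nat \<Rightarrow> (nat \<Rightarrow> nat) \<Rightarrow> bool" where
  "is_max_blowup n p \<longleftrightarrow> is_blowup_part n p \<and>
     (\<forall>q. is_blowup_part n q \<longrightarrow> card (blowup_edges n q) \<le> card (blowup_edges n p))"

definition M1 :: "nat hgraph set" where
  "M1 = {K5minus}"

definition M2 :: "nat hgraph set" where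
  "M2 = {F \<in> Kfam 7. \<exists>S. is_core F S 7 \<and> tau (induced F S) \<ge> 2}"

definition M3 :: "nat hgraph set" where
  "M3 = {F \<in> Kfam 6. (\<forall>n>0. \<not> contained F (G1 n)) \<and>
          (\<forall>n\<ge>6. \<forall>p. is_max_blowup n p \<longrightarrow> \<not> contained F ({0..<n}, blowup_edges n p))}"

definition MM :: "nat hgraph set" where
  "MM = M1 \<union> M2 \<union> M3"

end

theory Submission
  imports Defs "HOL-Library.FuncSet"
begin

text \<open>
  For nonnegative vertex weights \<open>w\<close> let \<open>P(w)\<close> be the sum over all edges of the product of the
  weights; a 3-graph has \<open>P(1, \<dots>, 1)\<close> edges, so it suffices to bound \<open>P(w)\<close> by \<open>2/27\<close> times the
  cube of the total weight. If no edge contains both \<open>u\<close> and \<open>v\<close>, then \<open>P\<close> is affine along the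
  direction that moves weight between \<open>u\<close> and \<open>v\<close>, so one of them can be discarded. Hence one may
  assume that every pair of vertices of the support \<open>S\<close> lies in an edge inside \<open>S\<close>. If \<open>|S| \<ge> 7\<close>,
  avoiding \<open>M2\<close> gives every 7-subset a vertex common to all its edges, and a Helly-type argument
  makes the whole graph a star. If \<open>|S| = 6\<close>, the graph is itself a member of the family of 3-graphs
  with a 6-core, so avoiding \<open>M3\<close> puts it inside \<open>G1\<close> or, its vertices lying in distinct parts,
  inside the 6-vertex graph \<open>G26\<close>. If \<open>|S| \<le> 5\<close>, avoiding \<open>K5minus\<close> leaves two non-edges, and the
  graph again embeds into \<open>G26\<close>. Stars, \<open>G1\<close> and \<open>G26\<close> all reduce to
  \<open>a b\<^sup>2 \<le> 4/27 (a + b)\<^sup>3\<close>. For the lower bound, a maximum blowup of \<open>G26\<close> avoids the family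
  and has at least the \<open>16 (n/6)\<^sup>3\<close> edges of the balanced one.
\<close>

section \<open>Lagrange polynomials of 3-graphs and shifting of weight\<close>

definition edge_weight :: "('a \<Rightarrow> real) \<Rightarrow> 'a set set \<Rightarrow> real" where
  "edge_weight w E = (\<Sum>e\<in>E. \<Prod>i\<in>e. w i)"

definition pair_covered :: "'a set set \<Rightarrow> 'a set \<Rightarrow> bool" where
  "pair_covered E S \<longleftrightarrow> (\<forall>u\<in>S. \<forall>v\<in>S. u \<noteq> v \<longrightarrow> (\<exists>e\<in>E. e \<subseteq> S \<and> {u, v} \<subseteq> e))"

text \<open>Since no edge contains both \<open>u\<close> and \<open>v\<close>, the polynomial has
  the form \<open>w u * L_u + w v * L_v + C\<close>, where the link sums \<open>L_u\<close>,
  \<open>L_v\<close> and the rest \<open>C\<close> involve neither \<open>w u\<close> nor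
  \<open>w v\<close>. Moving all weight of \<open>v\<close> to the vertex with the heavier link
  therefore loses nothing.\<close>

lemma edge_weight_shift:
  assumes "finite S" and nn: "\<And>i. i \<in> S \<Longrightarrow> 0 \<le> w i"
    and uv: "u \<in> S" "v \<in> S" "u \<noteq> v"
    and uncov: "\<not> (\<exists>e\<in>E. e \<subseteq> S \<and> {u, v} \<subseteq> e)"
    and le: "(\<Sum>e\<in>{e\<in>E. e \<subseteq> S \<and> v \<in> e}. \<Prod>i\<in>e - {v}. w i)
           \<le> (\<Sum>e\<in>{e\<in>E. e \<subseteq> S \<and> u \<in> e}. \<Prod>i\<in>e - {u}. w i)"
  shows "edge_weight w {e\<in>E. e \<subseteq> S} \<le> edge_weight (w(u := w u + w v)) {e\<in>E. e \<subseteq> S - {v}}"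
proof -
  let ?U = "{e\<in>E. e \<subseteq> S \<and> u \<in> e}" and ?V = "{e\<in>E. e \<subseteq> S \<and> v \<in> e}"
    and ?C = "{e\<in>E. e \<subseteq> S \<and> u \<notin> e \<and> v \<notin> e}"
  let ?w = "w(u := w u + w v)"
  have fin: "finite {e. e \<subseteq> S \<and> P e}" for P using \<open>finite S\<close> by simp
  have finE: "finite {e\<in>E. e \<subseteq> S \<and> P e}" for P
    by (rule finite_subset[OF _ fin[of "\<lambda>_. True"]]) auto
  have fe: "finite e" if "e \<subseteq> S" for e using that \<open>finite S\<close> finite_subset by blast
  have "edge_weight w {e\<in>E. e \<subseteq> S} = edge_weight w ?U + edge_weight w ?V + edge_weight w ?C"
  proof -
    have "{e\<in>E. e \<subseteq> S} = (?U \<union> ?V) \<union> ?C" by auto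
    moreover have "edge_weight w (?U \<union> ?V) = edge_weight w ?U + edge_weight w ?V"
      unfolding edge_weight_def using uncov by (intro sum.union_disjoint finE) auto
    moreover have "edge_weight w ((?U \<union> ?V) \<union> ?C) = edge_weight w (?U \<union> ?V) + edge_weight w ?C"
      unfolding edge_weight_def by (intro sum.union_disjoint finite_UnI finE) auto
    ultimately show ?thesis by simp
  qed
  moreover have pull: "edge_weight g {e\<in>E. e \<subseteq> S \<and> x \<in> e} =
      g x * (\<Sum>e\<in>{e\<in>E. e \<subseteq> S \<and> x \<in> e}. \<Prod>i\<in>e - {x}. g i)" for x g
    unfolding edge_weight_def sum_distrib_left
    by (rule sum.cong) (auto intro!: prod.remove fe)
  moreover have "edge_weight ?w {e\<in>E. e \<subseteq> S - {v}} = edge_weight ?w ?U + edge_weight ?w ?C"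
  proof -
    have "{e\<in>E. e \<subseteq> S - {v}} = ?U \<union> ?C" using uncov by auto
    moreover have "edge_weight ?w (?U \<union> ?C) = edge_weight ?w ?U + edge_weight ?w ?C"
      unfolding edge_weight_def by (intro sum.union_disjoint finE) auto
    ultimately show ?thesis by simp
  qed
  moreover have "edge_weight ?w ?C = edge_weight w ?C"
    unfolding edge_weight_def by (intro sum.cong prod.cong) auto
  \<comment> \<open>The update changes the weight of \<open>u\<close> only, and \<open>u\<close> is
    deleted from every product in its link sum.\<close>
  moreover have "edge_weight ?w ?U = (w u + w v) * (\<Sum>e\<in>?U. \<Prod>i\<in>e - {u}. w i)"
    unfolding pull by (auto intro!: arg_cong2[where f="(*)"] sum.cong prod.cong)
  moreover have "w v * (\<Sum>e\<in>?V. \<Prod>i\<in>e - {v}. w i) \<le> w v * (\<Sum>e\<in>?U. \<Prod>i\<in>e - {u}. w i)"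
    using le nn uv by (intro mult_left_mono) auto
  ultimately show ?thesis by (simp add: algebra_simps)
qed

text \<open>Symmetrization by induction on the size of \<open>S\<close>: an uncovered pair allows
  one of its vertices to be dropped while the total weight stays the same. The hypothesis ranges
  over all weights on \<open>T\<close> because each shift changes them.\<close>

lemma edge_weight_le_if_pair_covered:
  fixes w :: "'a \<Rightarrow> real"
  assumes "finite S" and "\<And>i. i \<in> S \<Longrightarrow> 0 \<le> w i"
    and "\<And>T w. T \<subseteq> S \<Longrightarrow> pair_covered E T \<Longrightarrow> (\<And>i. i \<in> T \<Longrightarrow> 0 \<le> w i) \<Longrightarrow>
           edge_weight w {e\<in>E. e \<subseteq> T} \<le> c * (sum w T) ^ 3"
  shows "edge_weight w {e\<in>E. e \<subseteq> S} \<le> c * (sum w S) ^ 3"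
  using assms
proof (induction "card S" arbitrary: S w)
  case 0
  \<comment> \<open>The empty set is vacuously pair covered, so the hypothesis applies
    directly.\<close>
  then show ?case by (auto simp: pair_covered_def)
next
  case (Suc k)
  show ?case
  proof (cases "pair_covered E S")
    case True
    then show ?thesis using Suc.prems by blast
  next
    case False
    then obtain u v where uv: "u \<in> S" "v \<in> S" "u \<noteq> v"
      and unc: "\<not> (\<exists>e\<in>E. e \<subseteq> S \<and> {u, v} \<subseteq> e)"
      unfolding pair_covered_def by blast
    \<comment> \<open>Stated for arbitrary \<open>u\<close> and \<open>v\<close>, so that it serves
      whichever of the two links is heavier.\<close>
    have step: "edge_weight w {e\<in>E. e \<subseteq> S} \<le> c * (sum w S) ^ 3"
      if uv: "u \<in> S" "v \<in> S" "u \<noteq> v" and unc: "\<not> (\<exists>e\<in>E. e \<subseteq> S \<and> {u, v} \<subseteq> e)"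
        and le: "(\<Sum>e\<in>{e\<in>E. e \<subseteq> S \<and> v \<in> e}. \<Prod>i\<in>e - {v}. w i)
           \<le> (\<Sum>e\<in>{e\<in>E. e \<subseteq> S \<and> u \<in> e}. \<Prod>i\<in>e - {u}. w i)" for u v
    proof -
      let ?w = "w(u := w u + w v)"
      have "edge_weight w {e\<in>E. e \<subseteq> S} \<le> edge_weight ?w {e\<in>E. e \<subseteq> S - {v}}"
        using edge_weight_shift[OF Suc.prems(1,2) uv unc le] by simp
      also have "\<dots> \<le> c * (sum ?w (S - {v})) ^ 3"
      proof (rule Suc.hyps(1))
        show "k = card (S - {v})" using Suc.hyps(2) uv Suc.prems(1) by simp
        show "0 \<le> ?w i" if "i \<in> S - {v}" for i
          using that uv Suc.prems(2) by (auto intro!: add_nonneg_nonneg)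
        show "edge_weight x {e\<in>E. e \<subseteq> T} \<le> c * (sum x T) ^ 3"
          if "T \<subseteq> S - {v}" "pair_covered E T" "\<And>i. i \<in> T \<Longrightarrow> 0 \<le> x i" for T x
          using that by (intro Suc.prems(3)) auto
      qed (use Suc.prems in auto)
      also have "sum ?w (S - {v}) = sum w S"
      proof -
        have "sum ?w (S - {v}) = ?w u + sum ?w (S - {v} - {u})"
          using Suc.prems(1) uv by (intro sum.remove) auto
        also have "sum ?w (S - {v} - {u}) = sum w (S - {v} - {u})" by (intro sum.cong) auto
        also have "?w u + \<dots> = w v + (w u + sum w (S - {v} - {u}))" by simp
        also have "w u + sum w (S - {v} - {u}) = sum w (S - {v})"
          using Suc.prems(1) uv by (intro sum.remove[symmetric]) auto
        also have "w v + \<dots> = sum w S"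
          using Suc.prems(1) uv by (intro sum.remove[symmetric]) auto
        finally show ?thesis .
      qed
      finally show ?thesis .
    qed
    show ?thesis
    proof (rule linorder_le_cases)
      show ?thesis
        if "(\<Sum>e\<in>{e\<in>E. e \<subseteq> S \<and> v \<in> e}. \<Prod>i\<in>e - {v}. w i)
           \<le> (\<Sum>e\<in>{e\<in>E. e \<subseteq> S \<and> u \<in> e}. \<Prod>i\<in>e - {u}. w i)"
        by (rule step[OF uv unc that])
      show ?thesis
        if "(\<Sum>e\<in>{e\<in>E. e \<subseteq> S \<and> u \<in> e}. \<Prod>i\<in>e - {u}. w i)
           \<le> (\<Sum>e\<in>{e\<in>E. e \<subseteq> S \<and> v \<in> e}. \<Prod>i\<in>e - {v}. w i)"
        by (rule step[OF uv(2,1) uv(3)[symmetric] _ that]) (use unc in auto)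
    qed
  qed
qed

section \<open>The weight bound when every edge meets a fixed set in exactly one vertex\<close>

text \<open>AM-GM for \<open>a\<close>, \<open>b/2\<close>, \<open>b/2\<close>. Equality at
  \<open>b = 2 * a\<close> shows up as the double root in the factorization of the
  difference.\<close>

lemma mult_square_le_cube: "a * b\<^sup>2 \<le> 4 / 27 * (a + b) ^ 3" if "0 \<le> a" "0 \<le> b" for a b :: real
proof -
  have "4 / 27 * (a + b) ^ 3 - a * b\<^sup>2 = (b - 2 * a)\<^sup>2 * (a + 4 * b) / 27"
    by (simp add: power2_eq_square power3_eq_cube algebra_simps)
  moreover have "0 \<le> (b - 2 * a)\<^sup>2 * (a + 4 * b) / 27" using that by simp
  ultimately show ?thesis by linarith
qed

text \<open>The square of the sum is twice the sum over pairs plus the sum of squares; each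
  induction step discards one term \<open>(w b)\<^sup>2 / 2\<close>.\<close>

lemma edge_weight_pairs_le:
  fixes w :: "'a \<Rightarrow> real"
  assumes "finite B"
  shows "edge_weight w {q. q \<subseteq> B \<and> card q = 2} \<le> (sum w B)\<^sup>2 / 2"
  using assms
proof (induction B)
  case empty
  have "{q. q \<subseteq> {} \<and> card q = 2} = ({} :: 'a set set)" by auto
  then show ?case by (simp add: edge_weight_def)
next
  case (insert b B)
  have eq: "{q. q \<subseteq> insert b B \<and> card q = 2} =
      {q. q \<subseteq> B \<and> card q = 2} \<union> (\<lambda>c. {b, c}) ` B" (is "?L = ?P \<union> ?Q")
  proof
    show "?P \<union> ?Q \<subseteq> ?L" using insert.hyps by (auto simp: card_insert_if)
    show "?L \<subseteq> ?P \<union> ?Q"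
    proof
      fix q assume q: "q \<in> ?L"
      show "q \<in> ?P \<union> ?Q"
      proof (cases "b \<in> q")
        case True
        with q obtain x y where "q = {x, y}" "x \<noteq> y" by (auto simp: card_2_iff)
        with True q show ?thesis by (auto simp: insert_commute)
      qed (use q in auto)
    qed
  qed
  have "edge_weight w ?L = edge_weight w ?P + edge_weight w ?Q"
    unfolding eq edge_weight_def using insert.hyps by (intro sum.union_disjoint) auto
  also have "edge_weight w ?Q = (\<Sum>c\<in>B. w b * w c)"
  proof -
    have "inj_on (\<lambda>c. {b, c}) B" by (auto simp: inj_on_def doubleton_eq_iff)
    moreover have "prod w {b, c} = w b * w c" if "c \<in> B" for c
      using that insert.hyps by (subst prod.insert) auto
    ultimately show ?thesis unfolding edge_weight_def by (simp add: sum.reindex)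
  qed
  also have "\<dots> = w b * sum w B" by (simp add: sum_distrib_left)
  also have "edge_weight w ?P + w b * sum w B \<le> (sum w B)\<^sup>2 / 2 + w b * sum w B"
    using insert.IH by simp
  also have "\<dots> \<le> (w b + sum w B)\<^sup>2 / 2" by (simp add: power2_eq_square algebra_simps)
  finally show ?case using insert.hyps by simp
qed

lemma edge_weight_mono:
  assumes "finite F" "E \<subseteq> F" "\<And>e i. e \<in> F \<Longrightarrow> i \<in> e \<Longrightarrow> 0 \<le> w i"
  shows "edge_weight w E \<le> edge_weight w F"
  unfolding edge_weight_def using assms by (intro sum_mono2 prod_nonneg) auto

text \<open>Each edge is a vertex of \<open>A\<close> together with a pair outside \<open>A\<close>.
  With total weights \<open>a\<close> inside and \<open>b\<close> outside, the sum is at most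
  \<open>a * b\<^sup>2 / 2\<close>. Stars are the case where \<open>A\<close> is a singleton;
  subgraphs of \<open>G1\<close> take the smaller side as \<open>A\<close>.\<close>

lemma edge_weight_le_if_split:
  fixes w :: "'a \<Rightarrow> real"
  assumes "finite S" and nn: "\<And>i. i \<in> S \<Longrightarrow> 0 \<le> w i"
    and E: "\<And>e. e \<in> E \<Longrightarrow> e \<subseteq> S \<and> card e = 3 \<and> card (e \<inter> A) = 1"
  shows "edge_weight w E \<le> 2 / 27 * (sum w S) ^ 3"
proof -
  let ?A = "S \<inter> A" and ?B = "S - A"
  let ?P = "{q. q \<subseteq> ?B \<and> card q = 2}"
  let ?h = "\<lambda>(a, q). insert a q"
  have fin: "finite (?A \<times> ?P)" using \<open>finite S\<close> by simp
  \<comment> \<open>Intersecting \<open>insert a q\<close> with \<open>A\<close> recovers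
    \<open>a\<close>, and removing \<open>A\<close> recovers \<open>q\<close>.\<close>
  have inj: "inj_on ?h (?A \<times> ?P)"
  proof (rule inj_onI, clarify)
    fix a q a' q' assume *: "a \<in> S" "a \<in> A" "a' \<in> S" "a' \<in> A" "q \<subseteq> S - A" "q' \<subseteq> S - A"
      "insert a q = insert a' q'"
    then have "insert a q \<inter> A = {a}" "insert a' q' \<inter> A = {a'}"
      "insert a q - A = q" "insert a' q' - A = q'" by auto
    with * show "a = a' \<and> q = q'" by auto
  qed
  have sub: "E \<subseteq> ?h ` (?A \<times> ?P)"
  proof
    fix e assume "e \<in> E"
    with E have e: "e \<subseteq> S" "card e = 3" "card (e \<inter> A) = 1" by auto
    then obtain a where a: "e \<inter> A = {a}" by (auto simp: card_1_singleton_iff)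
    have "card (e - A) = 2" using e \<open>finite S\<close> finite_subset[OF e(1)]
      by (simp add: card_Diff_subset_Int)
    moreover have "e = insert a (e - A)" using a by auto
    moreover have "a \<in> ?A" "e - A \<subseteq> ?B" using a e by auto
    ultimately show "e \<in> ?h ` (?A \<times> ?P)" by (intro image_eqI[of _ _ "(a, e - A)"]) auto
  qed
  have "edge_weight w E \<le> edge_weight w (?h ` (?A \<times> ?P))"
    using fin sub nn by (intro edge_weight_mono) auto
  also have "\<dots> = (\<Sum>(a, q)\<in>?A \<times> ?P. w a * (\<Prod>i\<in>q. w i))"
    unfolding edge_weight_def
  proof (subst sum.reindex[OF inj], rule sum.cong)
    fix x assume "x \<in> ?A \<times> ?P"
    then obtain a q where x: "x = (a, q)" "a \<in> A" "q \<subseteq> S - A" by auto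
    moreover have "finite q" using x(3) \<open>finite S\<close> by (meson finite_Diff finite_subset)
    ultimately show "((\<lambda>e. prod w e) \<circ> ?h) x = (case x of (a, q) \<Rightarrow> w a * (\<Prod>i\<in>q. w i))"
      by (auto intro!: prod.insert)
  qed simp
  also have "\<dots> = sum w ?A * edge_weight w ?P"
    unfolding edge_weight_def sum_product sum.cartesian_product ..
  also have "\<dots> \<le> sum w ?A * ((sum w ?B)\<^sup>2 / 2)"
    using \<open>finite S\<close> nn by (intro mult_left_mono edge_weight_pairs_le sum_nonneg) auto
  also have "\<dots> \<le> 2 / 27 * (sum w ?A + sum w ?B) ^ 3"
  proof -
    have "0 \<le> sum w ?A" "0 \<le> sum w ?B" using nn by (auto intro: sum_nonneg)
    then show ?thesis using mult_square_le_cube[of "sum w ?A" "sum w ?B"] by simp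
  qed
  also have "sum w ?A + sum w ?B = sum w S"
    using sum.Int_Diff[OF \<open>finite S\<close>, of w A] by simp
  finally show ?thesis .
qed

section \<open>The 3-graph \<open>G26_edges\<close> and its Lagrange polynomial\<close>

lemma card_3_sorted:
  fixes e :: "'a :: linorder set"
  assumes "card e = 3"
  obtains a b c where "e = {a, b, c}" "a < b" "b < c"
proof -
  from assms obtain x y z where e: "e = {x, y, z}" "x \<noteq> y" "x \<noteq> z" "y \<noteq> z"
    by (auto simp: card_3_iff)
  consider "x < y" "y < z" | "x < z" "z < y" | "y < x" "x < z" | "y < z" "z < x"
    | "z < x" "x < y" | "z < y" "y < x"
    using e by (metis linorder_neqE)
  then show ?thesis by cases (use e that in \<open>auto simp: insert_commute\<close>)
qed

text \<open>The list is arranged by the pairs {1,2}, {4,5}, {3,6}: first the four triples inside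
  {1,2,4,5}, then the eight transversals of the three pairs, then the four edges containing both 3
  and 6.\<close>

lemma G26_edges_eq: "G26_edges =
  {{1,2,4},{1,2,5},{1,4,5},{2,4,5},
   {1,3,4},{1,3,5},{2,3,4},{2,3,5},{1,4,6},{1,5,6},{2,4,6},{2,5,6},
   {1,3,6},{2,3,6},{3,4,6},{3,5,6}}" (is "_ = ?R")
proof
  show "?R \<subseteq> G26_edges"
    unfolding G26_edges_def triples_def by (simp add: set_eq_subset)
  show "G26_edges \<subseteq> ?R"
  proof
    fix e assume "e \<in> G26_edges"
    then have e: "e \<subseteq> {1..6}" "card e = 3" "e \<notin> {{1,2,3},{1,2,6},{3,4,5},{4,5,6}}"
      by (auto simp: G26_edges_def triples_def)
    from card_3_sorted[OF e(2)] obtain a b c where abc: "e = {a, b, c}" "a < b" "b < c" .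
    have "1 \<le> a" "c \<le> 6" using e(1) abc(1) by auto
    \<comment> \<open>Sortedness leaves four candidates in each position, so a finite check
      remains.\<close>
    with abc have "a = 1 \<or> a = 2 \<or> a = 3 \<or> a = 4" "b = 2 \<or> b = 3 \<or> b = 4 \<or> b = 5"
       "c = 3 \<or> c = 4 \<or> c = 5 \<or> c = 6"
      by presburger+
    with abc e(3) show "e \<in> ?R" by (elim disjE) simp_all
  qed
qed

lemma card_G26_edges: "card G26_edges = 16"
  unfolding G26_edges_eq by (simp add: set_eq_subset)

lemma edge_weight_G26_edges: "edge_weight y G26_edges =
    y 1 * y 2 * (y 4 + y 5) + y 4 * y 5 * (y 1 + y 2) + (y 3 + y 6) * (y 1 + y 2) * (y 4 + y 5)
    + y 3 * y 6 * (y 1 + y 2 + y 4 + y 5)"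
  unfolding G26_edges_eq edge_weight_def by (simp add: set_eq_subset algebra_simps)

text \<open>AM-GM inside each of the pairs {1,2}, {4,5}, {3,6} leaves an expression in the pair sums
  \<open>a\<close>, \<open>b\<close>, \<open>s\<close>, and AM-GM on \<open>a * b\<close> leaves one
  in \<open>a + b\<close> and \<open>s\<close>. That expression is half of
  \<open>x * y\<^sup>2\<close> with \<open>x = (a + b) / 2\<close> and \<open>y = x + s\<close>,
  where \<open>x + y\<close> is the total weight.\<close>

lemma edge_weight_G26_edges_le:
  assumes nn: "\<And>i. 0 \<le> y i"
  shows "edge_weight y G26_edges \<le> 2 / 27 * (y 1 + y 2 + y 3 + y 4 + y 5 + y 6) ^ 3"
proof -
  define a b s where "a = y 1 + y 2" and "b = y 4 + y 5" and "s = y 3 + y 6"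
  have nn': "0 \<le> a" "0 \<le> b" "0 \<le> s" using nn by (auto simp: a_def b_def s_def)
  have am_gm: "u * v \<le> (u + v)\<^sup>2 / 4" for u v :: real
    using zero_le_power2[of "u - v"] by (simp add: power2_eq_square algebra_simps)
  have "edge_weight y G26_edges = y 1 * y 2 * b + y 4 * y 5 * a + s * a * b + y 3 * y 6 * (a + b)"
    by (simp add: edge_weight_G26_edges a_def b_def s_def)
  also have "\<dots> \<le> a\<^sup>2 / 4 * b + b\<^sup>2 / 4 * a + s * a * b + s\<^sup>2 / 4 * (a + b)"
    using am_gm[of "y 1" "y 2"] am_gm[of "y 4" "y 5"] am_gm[of "y 3" "y 6"] nn'
    unfolding a_def[symmetric] b_def[symmetric] s_def[symmetric]
    by (intro add_mono mult_right_mono order_refl) auto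
  also have "\<dots> = (a * b) * ((a + b) / 4 + s) + s\<^sup>2 / 4 * (a + b)"
    by (simp add: power2_eq_square algebra_simps)
  also have "\<dots> \<le> (a + b)\<^sup>2 / 4 * ((a + b) / 4 + s) + s\<^sup>2 / 4 * (a + b)"
    using am_gm[of a b] nn' by (intro add_mono mult_right_mono order_refl) auto
  also have "\<dots> = (a + b) / 2 * ((a + b) / 2 + s)\<^sup>2 / 2"
    by (simp add: power2_eq_square field_simps)
  also have "\<dots> \<le> 2 / 27 * (a + b + s) ^ 3"
    using mult_square_le_cube[of "(a + b) / 2" "(a + b) / 2 + s"] nn' by (simp add: algebra_simps)
  finally show ?thesis by (simp add: a_def b_def s_def algebra_simps)
qed

text \<open>The weights are transported along \<open>f\<close> to the six vertices, where the
  polynomial bound is available.\<close>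

lemma edge_weight_le_if_inj_G26:
  fixes w :: "'a \<Rightarrow> real" and f :: "'a \<Rightarrow> nat"
  assumes "finite S" and nn: "\<And>i. i \<in> S \<Longrightarrow> 0 \<le> w i"
    and inj: "inj_on f S" and fS: "f ` S \<subseteq> {1..6}"
    and E: "\<And>e. e \<in> E \<Longrightarrow> e \<subseteq> S \<and> f ` e \<in> G26_edges"
  shows "edge_weight w E \<le> 2 / 27 * (sum w S) ^ 3"
proof -
  \<comment> \<open>Vertices outside the image get weight 0, so the total weight over
    \<open>{1..6}\<close> is still that of \<open>S\<close>.\<close>
  define y where "y j = (if j \<in> f ` S then w (inv_into S f j) else 0)" for j
  have y_f: "y (f i) = w i" if "i \<in> S" for i using that inj by (simp add: y_def)
  have y_nn: "0 \<le> y j" for j using nn by (auto simp: y_def inv_into_into)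
  have "edge_weight w E = (\<Sum>e\<in>E. \<Prod>j\<in>f ` e. y j)"
    unfolding edge_weight_def
  proof (rule sum.cong)
    fix e assume "e \<in> E"
    with E have e: "e \<subseteq> S" by blast
    show "prod w e = prod y (f ` e)"
      using e y_f by (subst prod.reindex) (auto intro!: prod.cong inj_on_subset[OF inj])
  qed simp
  also have "\<dots> = edge_weight y ((`) f ` E)"
    unfolding edge_weight_def using E
    by (subst sum.reindex) (auto intro!: inj_on_subset[OF inj_on_image_Pow[OF inj]])
  also have "\<dots> \<le> edge_weight y G26_edges"
  proof (rule edge_weight_mono)
    show "finite G26_edges" by (simp add: G26_edges_eq)
    show "(`) f ` E \<subseteq> G26_edges" using E by blast
  qed (rule y_nn)
  also have "\<dots> \<le> 2 / 27 * (y 1 + y 2 + y 3 + y 4 + y 5 + y 6) ^ 3"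
    using y_nn by (rule edge_weight_G26_edges_le)
  also have "y 1 + y 2 + y 3 + y 4 + y 5 + y 6 = sum y {1..6}"
    by (simp add: numeral_eq_Suc)
  also have "\<dots> = sum y (f ` S)"
    using fS by (intro sum.mono_neutral_right) (auto simp: y_def)
  also have "\<dots> = sum w S" using inj y_f by (subst sum.reindex) auto
  finally show ?thesis .
qed

section \<open>A Helly-type theorem for triples\<close>

text \<open>Edges spanning at most seven vertices share a vertex, which forces first pairs and then
  triples of edges to intersect. Without a global common vertex, some edge \<open>{a, b, c}\<close>
  and three edges missing \<open>a\<close>, \<open>b\<close>, \<open>c\<close> respectively would
  span at most seven vertices and yet share none.\<close>

lemma common_vertex_if_seven_sets:
  assumes "finite S" "7 \<le> card S" and X: "\<And>e. e \<in> X \<Longrightarrow> e \<subseteq> S \<and> card e = 3"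
    and seven: "\<And>T. T \<subseteq> S \<Longrightarrow> card T = 7 \<Longrightarrow> \<exists>v. \<forall>e\<in>X. e \<subseteq> T \<longrightarrow> v \<in> e"
  shows "\<exists>v. \<forall>e\<in>X. v \<in> e"
proof (rule ccontr)
  assume none: "\<nexists>v. \<forall>e\<in>X. v \<in> e"
  have fin: "finite e" if "e \<in> X" for e using X[OF that] \<open>finite S\<close> finite_subset by blast
  have common: "\<exists>v. \<forall>e\<in>Y. v \<in> e" if "Y \<subseteq> X" "card (\<Union>Y) \<le> 7" for Y
  proof -
    have "\<Union>Y \<subseteq> S" using that X by blast
    \<comment> \<open>The union is padded to exactly seven vertices inside \<open>S\<close>.\<close>
    from exists_subset_between[OF \<open>card (\<Union>Y) \<le> 7\<close> assms(2) this \<open>finite S\<close>]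
    obtain T where "\<Union>Y \<subseteq> T" "T \<subseteq> S" "card T = 7" by (elim exE conjE)
    from seven[OF \<open>T \<subseteq> S\<close> \<open>card T = 7\<close>] obtain v where v: "\<forall>e\<in>X. e \<subseteq> T \<longrightarrow> v \<in> e" ..
    have "v \<in> e" if "e \<in> Y" for e
      using v that \<open>Y \<subseteq> X\<close> \<open>\<Union>Y \<subseteq> T\<close> by (meson Sup_upper in_mono order_trans)
    then show ?thesis by blast
  qed
  have two: "e1 \<inter> e2 \<noteq> {}" if "e1 \<in> X" "e2 \<in> X" for e1 e2
  proof -
    have "card (\<Union>{e1, e2}) \<le> 7"
      using card_Un_le[of e1 e2] X[OF that(1)] X[OF that(2)] by simp
    with common[of "{e1, e2}"] that show ?thesis by auto
  qed
  have three: "\<exists>v. v \<in> e1 \<and> v \<in> e2 \<and> v \<in> e3" if "e1 \<in> X" "e2 \<in> X" "e3 \<in> X" for e1 e2 e3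
  proof -
    \<comment> \<open>Three triples have nine vertices with multiplicity; one overlap between the
      first two and one with the third bring this down to seven.\<close>
    have pos: "1 \<le> card (e1 \<inter> e2)" "1 \<le> card ((e1 \<union> e2) \<inter> e3)"
      using two[of e1 e2] two[of e1 e3] that fin by (auto simp: Suc_le_eq card_gt_0_iff)
    have "card (e1 \<union> e2) + card (e1 \<inter> e2) = 6"
      using card_Un_Int[of e1 e2] fin that X by simp
    moreover have "card (e1 \<union> e2 \<union> e3) + card ((e1 \<union> e2) \<inter> e3) = card (e1 \<union> e2) + 3"
      using card_Un_Int[of "e1 \<union> e2" e3] fin that X by simp
    ultimately have "card (\<Union>{e1, e2, e3}) \<le> 7" using pos by (simp add: Un_assoc)
    with common[of "{e1, e2, e3}"] that show ?thesis by auto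
  qed
  from none obtain e where e: "e \<in> X" by blast
  with X obtain a b c where abc: "e = {a, b, c}" "a \<noteq> b" "a \<noteq> c" "b \<noteq> c"
    by (metis card_3_iff)
  from none obtain ea eb ec where ex: "ea \<in> X" "a \<notin> ea" "eb \<in> X" "b \<notin> eb" "ec \<in> X" "c \<notin> ec"
    by metis
  \<comment> \<open>A vertex common to \<open>e\<close>, \<open>ea\<close> and \<open>eb\<close>
    lies in \<open>{a, b, c}\<close> but is neither \<open>a\<close> nor \<open>b\<close>, so it is
    \<open>c\<close>; the other pairs are analogous.\<close>
  have m: "c \<in> ea" "c \<in> eb" "b \<in> ea" "b \<in> ec" "a \<in> eb" "a \<in> ec"
    using three[OF e ex(1,3)] three[OF e ex(1,5)] three[OF e ex(3,5)] ex abc by auto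
  have one: "card (x - e) \<le> 1" if "x \<in> X" "y \<in> x" "z \<in> x" "y \<in> e" "z \<in> e" "y \<noteq> z" for x y z
  proof -
    have "card (x - e) \<le> card (x - {y, z})" using that fin by (intro card_mono) auto
    also have "\<dots> = 1" using that X[of x] fin by (subst card_Diff_subset) auto
    finally show ?thesis .
  qed
  \<comment> \<open>Each of \<open>ea\<close>, \<open>eb\<close>, \<open>ec\<close> has two vertices
    in \<open>e\<close>, hence at most one outside, so the four edges span at most 3 + 1 + 1 + 1
    vertices.\<close>
  have "card (\<Union>{e, ea, eb, ec}) = card (e \<union> ((ea - e) \<union> ((eb - e) \<union> (ec - e))))"
    by (rule arg_cong[of _ _ card]) auto
  also have "\<dots> \<le> card e + (card (ea - e) + (card (eb - e) + card (ec - e)))"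
    by (intro order_trans[OF card_Un_le] add_mono order_refl card_Un_le)
  also have "\<dots> \<le> 7"
    using one[of ea b c] one[of eb a c] one[of ec a b] ex m abc X[OF e] by simp
  finally obtain v where "\<forall>x\<in>{e, ea, eb, ec}. v \<in> x"
    using common[of "{e, ea, eb, ec}"] e ex by auto
  then show False using abc ex by auto
qed

section \<open>Containment, cores and transversals\<close>

lemma contained_trans: "contained F G \<Longrightarrow> contained G H \<Longrightarrow> contained F H"
  unfolding contained_def
proof (elim exE conjE)
  fix f g
  assume "inj_on f (fst F)" "f ` fst F \<subseteq> fst G" "\<forall>e\<in>snd F. f ` e \<in> snd G"
    "inj_on g (fst G)" "g ` fst G \<subseteq> fst H" "\<forall>e\<in>snd G. g ` e \<in> snd H"
  then show "\<exists>f. inj_on f (fst F) \<and> f ` fst F \<subseteq> fst H \<and> (\<forall>e\<in>snd F. f ` e \<in> snd H)"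
    by (intro exI[of _ "g \<circ> f"] conjI comp_inj_on)
      (auto simp: image_comp[symmetric] simp del: o_apply intro: inj_on_subset)
qed

lemma contained_subgraph: "V \<subseteq> V' \<Longrightarrow> E \<subseteq> E' \<Longrightarrow> contained (V, E) (V', E')"
  unfolding contained_def by (intro exI[of _ id]) auto

text \<open>One covering edge is chosen for each pair of \<open>T\<close>; it adds at most one
  vertex outside \<open>T\<close>, which gives the vertex bound of the family. All edges inside
  \<open>T\<close> are kept as well, so that the transversal number on the core is that of the host
  graph on \<open>T\<close>.\<close>

lemma Kfam_subgraph:
  fixes E :: "nat set set"
  assumes "finite V" "E \<subseteq> triples V" "T \<subseteq> V"
    and cov: "\<And>u v. u \<in> T \<Longrightarrow> v \<in> T \<Longrightarrow> u \<noteq> v \<Longrightarrow> \<exists>e\<in>E. {u, v} \<subseteq> e"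
  obtains F where "F \<in> Kfam (card T)" "is_core F T (card T)" "contained F (V, E)"
    "induced F T = (T, {e\<in>E. e \<subseteq> T})"
proof -
  let ?Q = "{q. q \<subseteq> T \<and> card q = 2}"
  have "finite T" using assms finite_subset by blast
  have "\<forall>q\<in>?Q. \<exists>e. e \<in> E \<and> q \<subseteq> e"
  proof
    fix q assume q: "q \<in> ?Q"
    then obtain u v where "q = {u, v}" "u \<noteq> v" by (auto simp: card_2_iff)
    with q cov[of u v] show "\<exists>e. e \<in> E \<and> q \<subseteq> e" by auto
  qed
  from bchoice[OF this] obtain c where "\<forall>q\<in>?Q. c q \<in> E \<and> q \<subseteq> c q" ..
  then have c: "c q \<in> E" "q \<subseteq> c q" if "q \<in> ?Q" for q using that by blast+
  have c3: "card (c q) = 3" "c q \<subseteq> V" if "q \<in> ?Q" for q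
    using c(1)[OF that] assms(2) by (auto simp: triples_def)
  let ?F = "(T \<union> \<Union>(c ` ?Q), {e\<in>E. e \<subseteq> T} \<union> c ` ?Q)"
  have finQ: "finite ?Q" using \<open>finite T\<close> by simp
  have core: "is_core ?F T (card T)"
    unfolding is_core_def
  proof (intro conjI ballI impI)
    fix u v assume "u \<in> T" "v \<in> T" "u \<noteq> v"
    then have "{u, v} \<in> ?Q" by auto
    then show "\<exists>e\<in>snd ?F. {u, v} \<subseteq> e" using c(2)[of "{u, v}"] by auto
  qed auto
  \<comment> \<open>Each pair \<open>q\<close> already lies in \<open>T\<close>, so only the single
    vertex of \<open>c q - q\<close> can be new.\<close>
  have "card (fst ?F) = card (T \<union> (\<Union>q\<in>?Q. c q - q))"
    by (rule arg_cong[of _ _ card]) (use c in auto)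
  also have "\<dots> \<le> card T + card (\<Union>q\<in>?Q. c q - q)" by (rule card_Un_le)
  also have "card (\<Union>q\<in>?Q. c q - q) \<le> (\<Sum>q\<in>?Q. card (c q - q))"
    by (rule card_UN_le[OF finQ])
  also have "(\<Sum>q\<in>?Q. card (c q - q)) = (\<Sum>q\<in>?Q. 1)"
  proof (rule sum.cong)
    fix q assume q: "q \<in> ?Q"
    then have "finite q" using \<open>finite T\<close> finite_subset by blast
    then show "card (c q - q) = 1" using c(2)[OF q] c3[OF q] q by (subst card_Diff_subset) auto
  qed simp
  also have "\<dots> = card T choose 2" using n_subsets[OF \<open>finite T\<close>, of 2] by simp
  finally have "card (fst ?F) \<le> card T + (card T choose 2)" by simp
  moreover have sub: "fst ?F \<subseteq> V" using assms(3) c3 by auto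
  moreover have "is_3graph ?F"
  proof -
    have "finite (fst ?F)" using assms(1) sub finite_subset by blast
    moreover have "snd ?F \<subseteq> triples (fst ?F)"
      using assms(2) c3 by (auto simp: triples_def)
    ultimately show ?thesis by (simp add: is_3graph_def)
  qed
  ultimately have "?F \<in> Kfam (card T)" using core unfolding Kfam_def by blast
  moreover have "contained ?F (V, E)"
    using sub c by (intro contained_subgraph) auto
  moreover have "induced ?F T = (T, {e\<in>E. e \<subseteq> T})"
    using c by (auto simp: induced_def)
  ultimately show ?thesis using core that by blast
qed

lemma common_vertex_if_tau_less_2:
  assumes "finite T" "\<And>e. e \<in> X \<Longrightarrow> e \<subseteq> T \<and> e \<noteq> {}" and "tau (T, X) < 2"
  shows "\<exists>v. \<forall>e\<in>X. v \<in> e"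
proof -
  let ?C = "{card C | C. C \<subseteq> T \<and> (\<forall>e\<in>X. C \<inter> e \<noteq> {})}"
  have "?C = card ` {C. C \<subseteq> T \<and> (\<forall>e\<in>X. C \<inter> e \<noteq> {})}" by auto
  then have "finite ?C" using assms(1) by simp
  \<comment> \<open>\<open>T\<close> itself is a transversal, because all edges are nonempty subsets
    of it; hence the minimum is attained.\<close>
  moreover have "card T \<in> ?C" using assms(2) by blast
  ultimately have "Min ?C \<in> ?C" by (intro Min_in) auto
  then obtain C where C: "C \<subseteq> T" "\<forall>e\<in>X. C \<inter> e \<noteq> {}" "card C < 2"
    using assms(3) unfolding tau_def by auto
  \<comment> \<open>Finiteness excludes an infinite \<open>C\<close>, whose \<open>card\<close>
    would be 0. If \<open>C\<close> is empty then so is \<open>X\<close>, and any vertex will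
    do.\<close>
  have "finite C" using C assms(1) finite_subset by blast
  then have "C = {} \<or> (\<exists>v. C = {v})"
    using C(3) by (metis One_nat_def card_0_eq card_1_singletonE less_2_cases)
  with C(2) show ?thesis by auto
qed

section \<open>Supports with at most five vertices\<close>

text \<open>If at most one triple were missing, mapping \<open>{0,1,2}\<close> onto it, or onto any
  triple when none is missing, would embed \<open>K5minus\<close>.\<close>

lemma five_vertices_two_non_edges:
  fixes S :: "'a set"
  assumes "card S = 5" and nc: "\<not> contained K5minus (S, E)"
  obtains T1 T2 where "T1 \<in> triples S - E" "T2 \<in> triples S - E" "T1 \<noteq> T2"
proof (rule ccontr)
  assume *: "\<not> thesis"
  note two = that
  have "finite S" using assms(1) card.infinite by force
  have uniq: "x = y" if "x \<in> triples S - E" "y \<in> triples S - E" for x y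
    using * two[OF that] by blast
  have "\<exists>T. T \<in> triples S \<and> triples S - E \<subseteq> {T}"
  proof (cases "triples S - E = {}")
    case True
    obtain T where "T \<subseteq> S" "card T = 3"
      using obtain_subset_with_card_n[of 3 S] assms(1) by auto
    with True show ?thesis by (auto simp: triples_def)
  next
    case False
    then obtain T where T: "T \<in> triples S - E" by blast
    then show ?thesis using uniq by blast
  qed
  then obtain T where T: "T \<in> triples S" and only: "triples S - E \<subseteq> {T}" by blast
  have T': "T \<subseteq> S" "card T = 3" using T by (auto simp: triples_def)
  then obtain a b c where abc: "T = {a, b, c}" "a \<noteq> b" "a \<noteq> c" "b \<noteq> c"
    by (metis card_3_iff)
  have "card (S - T) = 2" using T' assms(1) \<open>finite S\<close> finite_subset[OF T'(1)]
    by (simp add: card_Diff_subset)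
  then obtain d e where de: "S - T = {d, e}" "d \<noteq> e" by (auto simp: card_2_iff)
  then have de': "d \<in> S" "e \<in> S" "d \<notin> T" "e \<notin> T" by auto
  \<comment> \<open>The default value \<open>e\<close> is the image of the remaining vertex
    4.\<close>
  define g :: "nat \<Rightarrow> 'a" where "g = (\<lambda>_. e)(0 := a, 1 := b, 2 := c, 3 := d)"
  have five: "{0..<5::nat} = {0, 1, 2, 3, 4}" by auto
  have inj: "inj_on g {0..<5}" using abc de de' by (auto simp: five g_def)
  have gT: "g ` {0, 1, 2} = T" using abc by (auto simp: g_def)
  have gS: "g ` {0..<5} \<subseteq> S" using T' abc de' by (auto simp: five g_def)
  have "g ` x \<in> E" if x: "x \<in> triples {0..<5} - {{0, 1, 2}}" for x
  proof -
    have x': "x \<subseteq> {0..<5}" "card x = 3" "x \<noteq> {0, 1, 2}" using x by (auto simp: triples_def)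
    have "card (g ` x) = 3" using x' inj by (metis card_image inj_on_subset)
    then have "g ` x \<in> triples S" using x' gS by (auto simp: triples_def)
    moreover have "g ` x \<noteq> T"
      unfolding gT[symmetric] using x' inj_on_image_eq_iff[OF inj x'(1), of "{0, 1, 2}"] by auto
    ultimately show ?thesis using only by blast
  qed
  then have "contained K5minus (S, E)"
    unfolding contained_def K5minus_def using inj gS by (intro exI[of _ g]) auto
  with nc show False by contradiction
qed

lemma G26_edgesI:
  assumes "inj_on f S" "f ` S \<subseteq> {1..6}" "e \<subseteq> S" "card e = 3"
    "f ` e \<notin> {{1,2,3},{1,2,6},{3,4,5},{4,5,6}}"
  shows "f ` e \<in> G26_edges"
  using assms by (auto simp: G26_edges_def triples_def card_image inj_on_subset)

text \<open>All triples of {1,2,4,5} are edges of \<open>G26_edges\<close>, which settles at most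
  four vertices. On five vertices, two distinct missing triples share one or two vertices, and
  deleting a suitable vertex of \<open>G26_edges\<close> leaves exactly two non-edges with the same
  overlap.\<close>

lemma five_vertices_into_G26:
  fixes S :: "'a set"
  assumes "finite S" "card S \<le> 5" and E: "E \<subseteq> triples S" and nc: "\<not> contained K5minus (S, E)"
  shows "\<exists>f. inj_on f S \<and> f ` S \<subseteq> {1..6} \<and> (\<forall>e\<in>E. f ` e \<in> G26_edges)"
proof (cases "card S = 5")
  case False
  then have "card S \<le> card {1,2,4,5::nat}" using assms by simp
  then obtain f where f: "f ` S \<subseteq> {1,2,4,5::nat}" "inj_on f S"
    using card_le_inj[OF \<open>finite S\<close>, of "{1,2,4,5::nat}"] by auto
  have "f ` e \<in> G26_edges" if "e \<in> E" for e
  proof (rule G26_edgesI[OF f(2)])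
    show "e \<subseteq> S" "card e = 3" using that E by (auto simp: triples_def)
    then have "f ` e \<subseteq> {1,2,4,5}" using f by blast
    then show "f ` e \<notin> {{1,2,3},{1,2,6},{3,4,5},{4,5,6}}" by auto
  qed (use f in auto)
  then show ?thesis using f by (intro exI[of _ f]) auto
next
  case True
  from five_vertices_two_non_edges[OF True nc] obtain T1 T2
    where T: "T1 \<in> triples S - E" "T2 \<in> triples S - E" "T1 \<noteq> T2" .
  then have T': "T1 \<subseteq> S" "card T1 = 3" "T1 \<notin> E" "T2 \<subseteq> S" "card T2 = 3" "T2 \<notin> E"
    by (auto simp: triples_def)
  have fin: "finite T1" "finite T2" using T' \<open>finite S\<close> finite_subset by auto
  have un: "card (T1 \<union> T2) \<le> 5" using T' True \<open>finite S\<close> by (metis card_mono le_sup_iff)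
  have tot: "card (T1 \<union> T2) + card (T1 \<inter> T2) = 6" using card_Un_Int[OF fin] T' by simp
  have "card (T1 \<inter> T2) \<noteq> 3"
  proof
    assume "card (T1 \<inter> T2) = 3"
    then have "T1 \<inter> T2 = T1" "T1 \<inter> T2 = T2"
      using fin T' card_subset_eq[of T1 "T1 \<inter> T2"] card_subset_eq[of T2 "T1 \<inter> T2"] by auto
    with T(3) show False by auto
  qed
  moreover have "card (T1 \<inter> T2) \<le> 3" using T'(2) fin by (metis card_mono inf_le1)
  ultimately consider "card (T1 \<inter> T2) = 1" | "card (T1 \<inter> T2) = 2" using un tot by linarith
  then show ?thesis
  proof cases
    case 1
    have "card (T1 - T2) = 2" "card (T2 - T1) = 2"
      using 1 T' fin by (simp_all add: card_Diff_subset_Int Int_commute)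
    then obtain b c d e where bc: "T1 - T2 = {b, c}" "b \<noteq> c" and de: "T2 - T1 = {d, e}" "d \<noteq> e"
      by (auto simp: card_2_iff)
    obtain a where a: "T1 \<inter> T2 = {a}" using 1 by (auto simp: card_1_singleton_iff)
    have T1: "T1 = {a, b, c}" and T2: "T2 = {a, d, e}" using a bc de by auto
    have "T1 \<union> T2 = S" using T' True \<open>finite S\<close> tot 1 by (intro card_subset_eq) auto
    then have S: "S = {a, b, c, d, e}" using T1 T2 by auto
    have ne: "a \<noteq> b" "a \<noteq> c" "a \<noteq> d" "a \<noteq> e" "b \<noteq> d" "b \<noteq> e" "c \<noteq> d" "c \<noteq> e"
      using a bc de by auto
    \<comment> \<open>Vertex 3 is omitted: the non-edges left are {1,2,6} and {4,5,6}, meeting in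
      the image of \<open>a\<close>. The default 5 is the image of \<open>e\<close>.\<close>
    define f :: "'a \<Rightarrow> nat" where "f = (\<lambda>_. 5)(a := 6, b := 1, c := 2, d := 4)"
    have inj: "inj_on f S" using ne bc de by (auto simp: S f_def)
    have fS: "f ` S \<subseteq> {1,2,4,5,6}" by (auto simp: S f_def)
    have "f ` x \<in> G26_edges" if "x \<in> E" for x
    proof (rule G26_edgesI[OF inj])
      show x: "x \<subseteq> S" "card x = 3" using that E by (auto simp: triples_def)
      have "f ` x \<subseteq> {1,2,4,5,6}" using fS x by blast
      moreover have "f ` T1 = {1,2,6}" "f ` T2 = {4,5,6}" using ne bc de by (auto simp: T1 T2 f_def)
      moreover have "f ` x \<noteq> f ` T1" "f ` x \<noteq> f ` T2"
        using x T' that inj_on_image_eq_iff[OF inj x(1)] by auto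
      ultimately show "f ` x \<notin> {{1,2,3},{1,2,6},{3,4,5},{4,5,6}}" by auto
    qed (use fS in auto)
    then show ?thesis using inj fS by (intro exI[of _ f]) auto
  next
    case 2
    have "card (T1 - T2) = 1" "card (T2 - T1) = 1"
      using 2 T' fin by (simp_all add: card_Diff_subset_Int Int_commute)
    then obtain c d where c: "T1 - T2 = {c}" and d: "T2 - T1 = {d}"
      by (auto simp: card_1_singleton_iff)
    obtain a b where ab: "T1 \<inter> T2 = {a, b}" "a \<noteq> b" using 2 by (auto simp: card_2_iff)
    have T1: "T1 = {a, b, c}" and T2: "T2 = {a, b, d}" using ab c d by auto
    have "card (S - (T1 \<union> T2)) = 1"
      using T' True \<open>finite S\<close> tot 2 fin by (subst card_Diff_subset) auto
    then obtain e where e: "S - (T1 \<union> T2) = {e}" by (auto simp: card_1_singleton_iff)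
    have "S = (T1 \<union> T2) \<union> (S - (T1 \<union> T2))" using T' by blast
    also have "\<dots> = {a, b, c, d, e}" unfolding e unfolding T1 T2 by blast
    finally have S: "S = {a, b, c, d, e}" .
    have ne: "a \<noteq> c" "a \<noteq> d" "a \<noteq> e" "b \<noteq> c" "b \<noteq> d" "b \<noteq> e" "c \<noteq> d" "c \<noteq> e" "d \<noteq> e"
    proof -
      have "a \<in> T1" "a \<in> T2" "b \<in> T1" "b \<in> T2" "c \<in> T1" "d \<in> T2" using T1 T2 by blast+
      moreover have "c \<notin> T2" "d \<notin> T1" "e \<notin> T1" "e \<notin> T2" using c d e by blast+
      ultimately show "a \<noteq> c" "a \<noteq> d" "a \<noteq> e" "b \<noteq> c" "b \<noteq> d" "b \<noteq> e" "c \<noteq> d" "c \<noteq> e" "d \<noteq> e"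
        by metis+
    qed
    \<comment> \<open>Vertex 5 is omitted: the non-edges left are {1,2,3} and {1,2,6}, meeting in
      the images of \<open>a\<close> and \<open>b\<close>. The default 4 is the image of
      \<open>e\<close>.\<close>
    define f :: "'a \<Rightarrow> nat" where "f = (\<lambda>_. 4)(a := 1, b := 2, c := 3, d := 6)"
    have inj: "inj_on f S" using ne ab by (auto simp: S f_def)
    have fS: "f ` S \<subseteq> {1,2,3,4,6}" by (auto simp: S f_def)
    have "f ` x \<in> G26_edges" if "x \<in> E" for x
    proof (rule G26_edgesI[OF inj])
      show x: "x \<subseteq> S" "card x = 3" using that E by (auto simp: triples_def)
      have "f ` x \<subseteq> {1,2,3,4,6}" using fS x by blast
      moreover have "f ` T1 = {1,2,3}" "f ` T2 = {1,2,6}" using ne ab by (auto simp: T1 T2 f_def)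
      moreover have "f ` x \<noteq> f ` T1" "f ` x \<noteq> f ` T2"
        using x T' that inj_on_image_eq_iff[OF inj x(1)] by auto
      ultimately show "f ` x \<notin> {{1,2,3},{1,2,6},{3,4,5},{4,5,6}}" by auto
    qed (use fS in auto)
    then show ?thesis using inj fS by (intro exI[of _ f]) auto
  qed
qed

section \<open>The upper bound for free 3-graphs\<close>

text \<open>An edge of a blowup has its three vertices in three different parts, so two vertices
  covered by a common edge can never be sent to the same part.\<close>

lemma inj_on_part_if_covered:
  assumes cov: "\<And>u v. u \<in> T \<Longrightarrow> v \<in> T \<Longrightarrow> u \<noteq> v \<Longrightarrow> \<exists>e\<in>X. {u, v} \<subseteq> e"
    and X: "\<And>e. e \<in> X \<Longrightarrow> f ` e \<in> blowup_edges n p" and inj: "inj_on f T"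
  shows "inj_on (p \<circ> f) T"
proof (rule inj_onI, rule ccontr)
  fix u v assume uv: "u \<in> T" "v \<in> T" "(p \<circ> f) u = (p \<circ> f) v" "u \<noteq> v"
  then obtain e where e: "e \<in> X" "u \<in> e" "v \<in> e" using cov[of u v] by auto
  then have "card (f ` e) = 3" "card (p ` f ` e) = 3" using X
    by (auto simp: blowup_edges_def triples_def)
  then have "inj_on p (f ` e)" by (intro eq_card_imp_inj_on) (auto intro: card_ge_0_finite)
  then have "f u = f v" using e uv by (auto dest: inj_onD)
  then show False using uv inj by (auto dest: inj_onD)
qed

lemma edge_weight_le_if_free:
  fixes n :: nat
  assumes E: "E \<subseteq> triples {0..<n}" and free: "free MM ({0..<n}, E)"
    and S: "S \<subseteq> {0..<n}" and cov: "pair_covered E S" and nn: "\<And>i. i \<in> S \<Longrightarrow> 0 \<le> w i"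
  shows "edge_weight w {e\<in>E. e \<subseteq> S} \<le> 2 / 27 * (sum w S) ^ 3"
proof -
  let ?E = "{e\<in>E. e \<subseteq> S}"
  have "finite S" using finite_subset[OF S] by simp
  have ES: "e \<subseteq> S" "card e = 3" if "e \<in> ?E" for e using that E by (auto simp: triples_def)
  have tri: "?E \<subseteq> triples S" using ES by (auto simp: triples_def)
  have free_S: "\<not> contained F (S, ?E)" if "F \<in> MM" for F
  proof
    assume "contained F (S, ?E)"
    moreover have "contained (S, ?E) ({0..<n}, E)" using S by (intro contained_subgraph) auto
    ultimately have "contained F ({0..<n}, E)" by (rule contained_trans)
    with free that show False by (simp add: free_def)
  qed
  have cov': "\<exists>e\<in>?E. {u, v} \<subseteq> e" if "u \<in> S" "v \<in> S" "u \<noteq> v" for u v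
  proof -
    from cov that obtain e where "e \<in> E" "e \<subseteq> S" "{u, v} \<subseteq> e"
      unfolding pair_covered_def by meson
    then show ?thesis by (intro bexI[of _ e]) auto
  qed
  consider "card S \<le> 5" | "card S = 6" | "7 \<le> card S" by linarith
  then show ?thesis
  proof cases
    case 1
    have "\<not> contained K5minus (S, ?E)" by (rule free_S) (simp add: MM_def M1_def)
    from five_vertices_into_G26[OF \<open>finite S\<close> 1 tri this] obtain f
      where f: "inj_on f S" "f ` S \<subseteq> {1..6}" "\<forall>e\<in>?E. f ` e \<in> G26_edges" by blast
    show ?thesis
      by (rule edge_weight_le_if_inj_G26[OF \<open>finite S\<close> nn f(1,2)]) (use f(3) in auto)
  next
    case 2
    have "is_core (S, ?E) S 6" using cov' 2 by (auto simp: is_core_def)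
    then have K: "(S, ?E) \<in> Kfam 6"
      using \<open>finite S\<close> tri 2 by (auto simp: Kfam_def is_3graph_def)
    \<comment> \<open>The graph on \<open>S\<close> lies in the 6-core family and contains itself,
      so freeness keeps it out of \<open>M3\<close>; this can only be because it embeds into one of
      the two constructions.\<close>
    have "contained (S, ?E) (S, ?E)" by (rule contained_subgraph) auto
    then have "(S, ?E) \<notin> M3" using free_S[of "(S, ?E)"] by (auto simp: MM_def)
    then consider m where "contained (S, ?E) (G1 m)"
      | m p where "is_max_blowup m p" "contained (S, ?E) ({0..<m}, blowup_edges m p)"
      using K unfolding M3_def by blast
    then show ?thesis
    proof cases
      case 1
      then obtain f where f: "inj_on f S" "\<forall>e\<in>?E. f ` e \<in> snd (G1 m)"
        by (auto simp: contained_def)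
      \<comment> \<open>The preimage of the smaller side of \<open>G1 m\<close>, which every edge
        meets exactly once.\<close>
      let ?A = "{v. f v < m div 3}"
      have "card (e \<inter> ?A) = 1" if e: "e \<in> ?E" for e
      proof -
        from f(2) e have "f ` e \<in> snd (G1 m)" by blast
        then obtain a b b' where ab: "f ` e = {a, b, b'}" "a < m div 3" "m div 3 \<le> b" "m div 3 \<le> b'"
          by (auto simp: G1_def)
        have "f ` (e \<inter> ?A) = f ` e \<inter> {..<m div 3}" by auto
        also have "\<dots> = {a}" using ab by auto
        finally have "card (f ` (e \<inter> ?A)) = 1" by simp
        moreover have "inj_on f (e \<inter> ?A)" by (rule inj_on_subset[OF f(1)]) (use e in auto)
        ultimately show ?thesis by (simp add: card_image)
      qed
      with ES show ?thesis by (intro edge_weight_le_if_split[OF \<open>finite S\<close> nn]) auto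
    next
      case 2
      then obtain f where f: "inj_on f S" "f ` S \<subseteq> {0..<m}" "\<And>e. e \<in> ?E \<Longrightarrow> f ` e \<in> blowup_edges m p"
        by (auto simp: contained_def)
      have p: "p ` {0..<m} = {1..6}" using 2 by (simp add: is_max_blowup_def is_blowup_part_def)
      show ?thesis
      proof (rule edge_weight_le_if_inj_G26[OF \<open>finite S\<close> nn])
        show "inj_on (p \<circ> f) S" by (rule inj_on_part_if_covered[OF cov' f(3) f(1)])
        show "(p \<circ> f) ` S \<subseteq> {1..6}" unfolding p[symmetric] using f(2) by auto
        show "e \<subseteq> S \<and> (p \<circ> f) ` e \<in> G26_edges" if "e \<in> ?E" for e
          using f(3)[OF that] that by (auto simp: blowup_edges_def image_comp)
      qed
    qed
  next
    case 3
    have "\<exists>v. \<forall>e\<in>?E. e \<subseteq> T \<longrightarrow> v \<in> e" if T: "T \<subseteq> S" "card T = 7" for T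
    proof -
      \<comment> \<open>The covering edges lie in \<open>S\<close> but may leave \<open>T\<close>;
        they provide the vertices outside the core of \<open>F\<close>.\<close>
      have cT: "\<exists>e\<in>?E. {u, v} \<subseteq> e" if "u \<in> T" "v \<in> T" "u \<noteq> v" for u v
        using cov'[of u v] that T(1) by blast
      obtain F where F: "F \<in> Kfam (card T)" "is_core F T (card T)" "contained F (S, ?E)"
        "induced F T = (T, {e\<in>?E. e \<subseteq> T})"
        by (rule Kfam_subgraph[OF \<open>finite S\<close> tri T(1) cT])
      then have "F \<notin> M2" using free_S[of F] by (auto simp: MM_def)
      then have "\<not> 2 \<le> tau (induced F T)" using F(1,2) T(2) unfolding M2_def by auto
      then have tau: "tau (T, {e\<in>?E. e \<subseteq> T}) < 2" unfolding F(4) by simp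
      have ne: "e \<subseteq> T \<and> e \<noteq> {}" if "e \<in> {e\<in>?E. e \<subseteq> T}" for e using ES[of e] that by auto
      have "finite T" using T(1) \<open>finite S\<close> finite_subset by blast
      from common_vertex_if_tau_less_2[OF this ne tau] show ?thesis by (simp add: imp_conjL)
    qed
    then have "\<exists>v. \<forall>e\<in>?E. v \<in> e"
      using ES by (intro common_vertex_if_seven_sets[OF \<open>finite S\<close> 3] conjI)
    then obtain v where v: "\<forall>e\<in>?E. v \<in> e" ..
    have "card (e \<inter> {v}) = 1" if "e \<in> ?E" for e
    proof -
      have "e \<inter> {v} = {v}" using v that by blast
      then show ?thesis by simp
    qed
    with ES show ?thesis by (intro edge_weight_le_if_split[OF \<open>finite S\<close> nn]) auto
  qed
qed

lemma card_le_if_free: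
  assumes "E \<subseteq> triples {0..<n}" "free MM ({0..<n}, E)"
  shows "real (card E) \<le> 2 * real n ^ 3 / 27"
proof -
  have "edge_weight (\<lambda>_. 1) {e\<in>E. e \<subseteq> {0..<n}} \<le> 2 / 27 * (sum (\<lambda>_. 1) {0..<n}) ^ 3"
    by (rule edge_weight_le_if_pair_covered) (use edge_weight_le_if_free[OF assms] in auto)
  moreover have "{e\<in>E. e \<subseteq> {0..<n}} = E" using assms(1) by (auto simp: triples_def)
  ultimately show ?thesis by (simp add: edge_weight_def)
qed

section \<open>The lower bound by blowups of \<open>G26_edges\<close>\<close>

lemma K5minus_covered:
  assumes "u \<in> {0..<5}" "v \<in> {0..<5}" "u \<noteq> v"
  shows "\<exists>e\<in>snd K5minus. {u, v} \<subseteq> e"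
proof -
  \<comment> \<open>The third vertex is chosen so that the triple contains 3 or 4 and hence differs
    from the missing triple \<open>{0,1,2}\<close>.\<close>
  define w :: nat where "w = (if 3 \<notin> {u, v} then 3 else if 4 \<notin> {u, v} then 4 else 0)"
  have w: "w < 5" "w \<noteq> u" "w \<noteq> v" using assms by (auto simp: w_def)
  have "3 \<in> {u, v, w} \<or> 4 \<in> {u, v, w}" by (auto simp: w_def)
  then have "{u, v, w} \<noteq> {0, 1, 2}" by auto
  moreover have "{u, v, w} \<in> triples {0..<5}" using assms w by (auto simp: triples_def)
  ultimately show ?thesis unfolding K5minus_def by (intro bexI[of _ "{u, v, w}"]) auto
qed

text \<open>All pairs of \<open>K5minus\<close> are covered, so its five vertices occupy five
  different parts and miss one part \<open>m\<close>. Every vertex of \<open>G26_edges\<close> is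
  avoided by two of the four non-edges, whereas \<open>K5minus\<close> lacks only one
  triple.\<close>

lemma K5minus_not_contained_blowup:
  assumes "is_blowup_part n p"
  shows "\<not> contained K5minus ({0..<n}, blowup_edges n p)"
proof
  assume "contained K5minus ({0..<n}, blowup_edges n p)"
  then obtain f where f: "inj_on f {0..<5}" "f ` {0..<5} \<subseteq> {0..<n}"
    "\<And>e. e \<in> snd K5minus \<Longrightarrow> f ` e \<in> blowup_edges n p"
    by (auto simp: contained_def K5minus_def)
  let ?g = "p \<circ> f"
  have inj: "inj_on ?g {0..<5}"
    by (rule inj_on_part_if_covered[OF K5minus_covered f(3) f(1)])
  have sub: "?g ` {0..<5} \<subseteq> {1..6}"
    using assms f(2) unfolding is_blowup_part_def by auto
  have "card (?g ` {0..<5}) = 5" using card_image[OF inj] by simp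
  then have "card ({1..6} - ?g ` {0..<5}) = 1" using sub by (subst card_Diff_subset) auto
  then obtain m where m: "{1..6} - ?g ` {0..<5} = {m}" by (auto simp: card_1_singleton_iff)
  \<comment> \<open>A non-edge avoiding \<open>m\<close> is the image of some triple of
    \<open>K5minus\<close> vertices, which must be the missing one. Two such non-edges would
    therefore coincide.\<close>
  have bad: "B = ?g ` {0, 1, 2}" if B: "B \<subseteq> {1..6}" "m \<notin> B" "card B = 3" "B \<notin> G26_edges" for B
  proof -
    have "B \<subseteq> ?g ` {0..<5}"
    proof
      fix j assume "j \<in> B"
      then have "j \<in> {1..6}" "j \<notin> {1..6} - ?g ` {0..<5}" unfolding m using B(1,2) by blast+
      then show "j \<in> ?g ` {0..<5}" by blast
    qed
    then obtain x where x: "x \<subseteq> {0..<5}" "B = ?g ` x" by (auto simp: subset_image_iff)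
    then have "card x = 3" using B(3) inj by (metis card_image inj_on_subset)
    then have "x \<in> triples {0..<5}" using x by (simp add: triples_def)
    moreover have "x \<notin> snd K5minus"
      using f(3)[of x] B(4) x(2) by (auto simp: blowup_edges_def image_comp)
    ultimately show ?thesis using x by (simp add: K5minus_def)
  qed
  have "m \<in> {1..6}" using m by blast
  then consider "m = 1 \<or> m = 2" | "m = 3" | "m = 4 \<or> m = 5" | "m = 6" by fastforce
  then show False
  proof cases
    case 1
    then have "{3,4,5} = ?g ` {0, 1, 2}" "{4,5,6} = ?g ` {0, 1, 2}"
      by (intro bad; auto simp: G26_edges_def)+
    then have "{3,4,5} = {4,5,6::nat}" by simp
    then show False by (simp add: set_eq_subset)
  next
    case 2
    then have "{1,2,6} = ?g ` {0, 1, 2}" "{4,5,6} = ?g ` {0, 1, 2}"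
      by (intro bad; auto simp: G26_edges_def)+
    then have "{1,2,6} = {4,5,6::nat}" by simp
    then show False by (simp add: set_eq_subset)
  next
    case 3
    then have "{1,2,3} = ?g ` {0, 1, 2}" "{1,2,6} = ?g ` {0, 1, 2}"
      by (intro bad; auto simp: G26_edges_def)+
    then have "{1,2,3} = {1,2,6::nat}" by simp
    then show False by (simp add: set_eq_subset)
  next
    case 4
    then have "{1,2,3} = ?g ` {0, 1, 2}" "{3,4,5} = ?g ` {0, 1, 2}"
      by (intro bad; auto simp: G26_edges_def)+
    then have "{1,2,3} = {3,4,5::nat}" by simp
    then show False by (simp add: set_eq_subset)
  qed
qed

text \<open>A 7-core would need seven distinct parts, which excludes \<open>M2\<close>;
  \<open>M3\<close> is excluded by its definition. As \<open>M3\<close> refers to maximum blowups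
  only, it is a maximum blowup rather than the balanced one that is shown to be free.\<close>

lemma free_max_blowup:
  assumes max: "is_max_blowup n p" and "6 \<le> n"
  shows "free MM ({0..<n}, blowup_edges n p)"
  unfolding free_def
proof
  fix F assume "F \<in> MM"
  have part: "is_blowup_part n p" using max by (simp add: is_max_blowup_def)
  consider "F = K5minus" | "F \<in> M2" | "F \<in> M3" using \<open>F \<in> MM\<close> by (auto simp: MM_def M1_def)
  then show "\<not> contained F ({0..<n}, blowup_edges n p)"
  proof cases
    case 1
    then show ?thesis using K5minus_not_contained_blowup[OF part] by simp
  next
    case 2
    then obtain S where S: "S \<subseteq> fst F" "card S = 7"
      and cov: "\<And>u v. u \<in> S \<Longrightarrow> v \<in> S \<Longrightarrow> u \<noteq> v \<Longrightarrow> \<exists>e\<in>snd F. {u, v} \<subseteq> e"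
      by (auto simp: M2_def is_core_def)
    show ?thesis
    proof
      assume "contained F ({0..<n}, blowup_edges n p)"
      then obtain f where f: "inj_on f (fst F)" "f ` fst F \<subseteq> {0..<n}"
        "\<And>e. e \<in> snd F \<Longrightarrow> f ` e \<in> blowup_edges n p"
        by (auto simp: contained_def)
      have "inj_on (p \<circ> f) S"
        by (rule inj_on_part_if_covered[OF cov f(3) inj_on_subset[OF f(1) S(1)]])
      moreover have "(p \<circ> f) ` S \<subseteq> p ` {0..<n}" using f(2) S(1) by auto
      then have "(p \<circ> f) ` S \<subseteq> {1..6}" using part unfolding is_blowup_part_def by (simp only:)
      ultimately have "card S \<le> card {1..6::nat}" by (metis card_inj_on_le finite_atLeastAtMost)
      with S(2) show False by simp
    qed
  next
    case 3
    then show ?thesis using assms by (auto simp: M3_def)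
  qed
qed

text \<open>The parts are the residue classes modulo 6, each of size \<open>k\<close>. Each of the
  16 edges \<open>G\<close> of \<open>G26_edges\<close>, with a choice \<open>\<phi>\<close> of one
  vertex in each of its three parts, gives a distinct edge.\<close>

lemma card_balanced_blowup:
  "16 * k ^ 3 \<le> card (blowup_edges (6 * k) (\<lambda>i. i mod 6 + 1))"
proof -
  let ?p = "\<lambda>i::nat. i mod 6 + 1"
  let ?D = "SIGMA G:G26_edges. G \<rightarrow>\<^sub>E {0..<k}"
  \<comment> \<open>This is vertex number \<open>\<phi> j\<close> of part \<open>j\<close>: the
    remainder modulo 6 recovers \<open>j\<close>, shifted by one, and the quotient recovers
    \<open>\<phi> j\<close>.\<close>
  let ?m = "\<lambda>\<phi> j. 6 * \<phi> j + (j - 1) :: nat"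
  let ?h = "\<lambda>(G, \<phi>). ?m \<phi> ` G"
  have G: "G \<subseteq> {1..6}" "card G = 3" "finite G" if "G \<in> G26_edges" for G
    using that by (auto simp: G26_edges_def triples_def intro: card_ge_0_finite)
  have fin: "finite G26_edges" by (simp add: G26_edges_eq)
  have pm: "?p (?m \<phi> j) = j" "?m \<phi> j div 6 = \<phi> j" if "j \<in> {1..6}" for \<phi> j
  proof -
    from that obtain i where "j = Suc i" "i < 6" by (cases j) auto
    then show "?p (?m \<phi> j) = j" "?m \<phi> j div 6 = \<phi> j" by simp_all
  qed
  have img: "?p ` ?m \<phi> ` G = G" if "G \<in> G26_edges" for \<phi> G
    unfolding image_image using G[OF that] pm(1)[of _ \<phi>] by (simp add: subset_iff cong: image_cong)
  have "card ?D = (\<Sum>G\<in>G26_edges. card (G \<rightarrow>\<^sub>E {0..<k}))"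
    using fin G by (intro card_SigmaI) (auto intro!: finite_PiE)
  also have "\<dots> = (\<Sum>G\<in>G26_edges. k ^ 3)"
    using G by (intro sum.cong) (auto simp: card_PiE)
  also have "\<dots> = 16 * k ^ 3" by (simp add: card_G26_edges)
  finally have "16 * k ^ 3 = card ?D" ..
  also have "\<dots> \<le> card (blowup_edges (6 * k) ?p)"
  proof (rule card_inj_on_le)
    show "inj_on ?h ?D"
    proof (rule inj_onI, clarify)
      fix G \<phi> G' \<psi>
      assume a: "G \<in> G26_edges" "\<phi> \<in> G \<rightarrow>\<^sub>E {0..<k}" "G' \<in> G26_edges" "\<psi> \<in> G' \<rightarrow>\<^sub>E {0..<k}"
        and eq: "?m \<phi> ` G = ?m \<psi> ` G'"
      \<comment> \<open>Projecting an edge to its set of parts recovers \<open>G\<close>.\<close>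
      have "G = G'" using img[OF a(1), of \<phi>] img[OF a(3), of \<psi>] eq by simp
      moreover have "\<phi> = \<psi>"
      proof (rule PiE_ext[OF a(2)])
        show "\<psi> \<in> G \<rightarrow>\<^sub>E {0..<k}" using a(4) \<open>G = G'\<close> by simp
        fix j assume j: "j \<in> G"
        then obtain i where i: "i \<in> G" "?m \<phi> j = ?m \<psi> i" using eq \<open>G = G'\<close> by blast
        have ij: "i \<in> {1..6}" "j \<in> {1..6}" using i j G(1)[OF a(1)] by auto
        have "i = j" using pm(1)[OF ij(1), of \<psi>] pm(1)[OF ij(2), of \<phi>] unfolding i(2) by (rule trans[OF sym])
        then show "\<phi> j = \<psi> j"
          using pm(2)[OF ij(2), of \<phi>] pm(2)[OF ij(1), of \<psi>] unfolding i(2) by simp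
      qed
      ultimately show "G = G' \<and> \<phi> = \<psi>" by simp
    qed
    show "?h ` ?D \<subseteq> blowup_edges (6 * k) ?p"
    proof clarify
      fix G \<phi> assume a: "G \<in> G26_edges" "\<phi> \<in> G \<rightarrow>\<^sub>E {0..<k}"
      have "inj_on (?m \<phi>) G"
      proof (rule inj_onI)
        fix i j assume "i \<in> G" "j \<in> G" and e: "?m \<phi> i = ?m \<phi> j"
        then have ij: "i \<in> {1..6}" "j \<in> {1..6}" using G(1)[OF a(1)] by auto
        show "i = j" using pm(1)[OF ij(1), of \<phi>] pm(1)[OF ij(2), of \<phi>] unfolding e by (rule trans[OF sym])
      qed
      then have "card (?m \<phi> ` G) = 3" using G(2)[OF a(1)] by (simp add: card_image)
      moreover have "?m \<phi> j < 6 * k" if "j \<in> G" for j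
      proof -
        have "\<phi> j < k" "j \<le> 6" "1 \<le> j" using a(2) that G(1)[OF a(1)] by auto
        then show ?thesis by linarith
      qed
      ultimately show "?m \<phi> ` G \<in> blowup_edges (6 * k) ?p"
        using img[OF a(1), of \<phi>] a(1) G(2)[OF a(1)]
        by (auto simp: blowup_edges_def triples_def)
    qed
    show "finite (blowup_edges (6 * k) ?p)"
      by (rule finite_subset[of _ "Pow {0..<6 * k}"]) (auto simp: blowup_edges_def triples_def)
  qed
  finally show ?thesis .
qed

lemma is_max_blowup_exists:
  assumes "is_blowup_part n q"
  obtains p where "is_max_blowup n p"
proof -
  have "card (blowup_edges n p) \<le> card (Pow {0..<n})" for p
    by (intro card_mono) (auto simp: blowup_edges_def triples_def)
  then obtain p where "is_blowup_part n p"
    "\<forall>r. is_blowup_part n r \<longrightarrow> card (blowup_edges n r) \<le> card (blowup_edges n p)"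
    using ex_has_greatest_nat[of "is_blowup_part n" q "\<lambda>p. card (blowup_edges n p)" "Suc (card (Pow {0..<n}))"]
      assms le_imp_less_Suc by blast
  then show ?thesis using that by (auto simp: is_max_blowup_def)
qed

text \<open>Every member of the family has an edge, since a core contains a pair that must be
  covered. This makes the set whose maximum defines \<open>ex\<close> nonempty.\<close>

lemma free_MM_empty: "free MM (V, {})"
proof -
  have "snd F \<noteq> {}" if "F \<in> MM" for F
  proof -
    have core: "snd F \<noteq> {}" if "F \<in> Kfam k" "2 \<le> k" for k
    proof -
      from that(1) obtain S where S: "card S = k"
        "\<forall>u\<in>S. \<forall>v\<in>S. u \<noteq> v \<longrightarrow> (\<exists>e\<in>snd F. {u, v} \<subseteq> e)"
        by (auto simp: Kfam_def is_core_def)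
      from S(1) that(2) obtain T where "T \<subseteq> S" "card T = 2"
        using obtain_subset_with_card_n[of 2 S] by auto
      then obtain u v where "u \<in> S" "v \<in> S" "u \<noteq> v" by (auto simp: card_2_iff)
      with S(2) show ?thesis by blast
    qed
    have "snd K5minus \<noteq> {}" using K5minus_covered[of 0 1] by auto
    then show ?thesis using that core[of 6] core[of 7] by (auto simp: MM_def M1_def M2_def M3_def)
  qed
  then show ?thesis unfolding free_def contained_def by fastforce
qed

theorem theorem1p7:
  fixes n :: nat
  assumes "n > 0"
  shows "real (ex n MM) \<le> 2 * real n ^ 3 / 27 \<and>
         (6 dvd n \<longrightarrow> real (ex n MM) = 2 * real n ^ 3 / 27)"
proof -
  let ?X = "{card E | E. E \<subseteq> triples {0..<n} \<and> free MM ({0..<n}, E)}"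
  have tri: "finite (triples {0..<n})" by (simp add: triples_def)
  have "?X = card ` {E. E \<subseteq> triples {0..<n} \<and> free MM ({0..<n}, E)}" by auto
  then have fin: "finite ?X" using tri by simp
  have "0 \<in> ?X" using free_MM_empty[of "{0..<n}"] by (auto intro!: exI[of _ "{}"])
  then have "Max ?X \<in> ?X" using fin by (intro Max_in) auto
  then obtain E where "ex n MM = card E" "E \<subseteq> triples {0..<n}" "free MM ({0..<n}, E)"
    by (auto simp: ex_def)
  then have upper: "real (ex n MM) \<le> 2 * real n ^ 3 / 27" using card_le_if_free by simp
  have "2 * real n ^ 3 / 27 \<le> real (ex n MM)" if "6 dvd n"
  proof -
    from that obtain k where k: "n = 6 * k" ..
    let ?q = "\<lambda>i::nat. i mod 6 + 1"
    have "6 \<le> n" using k assms by auto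
    have "is_blowup_part n ?q"
      unfolding is_blowup_part_def
    proof
      show "{1..6} \<subseteq> ?q ` {0..<n}"
      proof
        fix j :: nat assume "j \<in> {1..6}"
        \<comment> \<open>Already the first six vertices meet all six parts.\<close>
        then have "j = ?q (j - 1)" "j - 1 \<in> {0..<n}" using \<open>6 \<le> n\<close> by auto
        then show "j \<in> ?q ` {0..<n}" by blast
      qed
    qed (auto simp: Suc_le_eq)
    moreover from is_max_blowup_exists[OF this] obtain p where p: "is_max_blowup n p" .
    ultimately have "card (blowup_edges n ?q) \<le> card (blowup_edges n p)"
      by (auto simp: is_max_blowup_def)
    also have "\<dots> \<le> ex n MM"
      unfolding ex_def
    proof (rule Max_ge[OF fin], intro CollectI exI conjI)
      show "free MM ({0..<n}, blowup_edges n p)" by (rule free_max_blowup[OF p \<open>6 \<le> n\<close>])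
    qed (auto simp: blowup_edges_def)
    finally have "16 * k ^ 3 \<le> ex n MM" using card_balanced_blowup[of k] k by simp
    \<comment> \<open>With \<open>n = 6 * k\<close> the target is
      \<open>2 * (6 * k) ^ 3 / 27 = 16 * k ^ 3\<close>.\<close>
    then have "16 * real k ^ 3 \<le> real (ex n MM)" by (metis of_nat_le_iff of_nat_mult of_nat_numeral of_nat_power)
    then show ?thesis using k by (simp add: power_mult_distrib)
  qed
  with upper show ?thesis by fastforce
qed

end
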